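(* Let $X, d$ be a continuous Yoneda-complete quasi-metric space. For every $\alpha \in \mathbb{R}_+$, the topology of $\mathcal{L}_\alpha (X, d)$ (resp., of $\mathcal{L}_\alpha^a (X, d)$, for any real $a > 0$) coincides with the topology of pointwise convergence.
   Context: $\mathbb{R}_+=[0,+\infty)$. A quasi-metric on $X$ is a map $d \colon X \times X \to [0,+\infty]$ with $d(x,x)=0$, the triangle inequality, and $d(x,y)=d(y,x)=0 \Rightarrow x=y$. Formal balls are pairs $(x,r)$, $x\in X$, $r\in \mathbb{R}_+$, ordered by $(x,r) \leq^{d^+} (y,s)$ iff $d(x,y) \leq r-s$; they form the poset $\mathbf{B}(X,d)$, with its Scott topology. $X$ is given the $d$-Scott topology, the coarsest one making $x \mapsto (x,0) \in \mathbf{B}(X,d)$ continuous. $X,d$ is continuous Yoneda-complete iff $\mathbf{B}(X,d)$ is a continuous dcpo. $[0,+\infty]$ carries the quasi-metric $\mathsf{d}_{\mathbb R}$ with $\mathsf{d}_{\mathbb R}(x,y)=0$ if $x \leq y$, $\mathsf{d}_{\mathbb R}(+\infty,y)=+\infty$ if $y\neq+\infty$, and $\mathsf{d}_{\mathbb R}(x,y)=x-y$ if $+\infty > x>y$; its $\mathsf{d}_{\mathbb R}$-Scott topology is the Scott topology. A map $f \colon X,d \to Y,\partial$ is $\alpha$-Lipschitz continuous iff $(x,r) \mapsto (f(x),\alpha r)$ is Scott-continuous from $\mathbf{B}(X,d)$ to $\mathbf{B}(Y,\partial)$. $\mathcal{L} X$ is the set of lower semicontinuous maps from $X$ to $[0,+\infty]$,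 with the Scott topology of the pointwise ordering. $\mathcal{L}_\alpha(X,d)$ is the set of $\alpha$-Lipschitz continuous maps from $X,d$ to $[0,+\infty],\mathsf{d}_{\mathbb R}$, and $\mathcal{L}_\alpha^a(X,d)$ is the set of those bounded above by $\alpha a$ (i.e. with values in $[0,\alpha a]$); both are included in $\mathcal{L} X$ and are given the subspace topology from $\mathcal{L} X$. The topology of pointwise convergence has the sets $\{f \mid f(x) > r\}$, $x \in X$, $r \in \mathbb{R}_+$, as subbase. *)

theory Defs
  imports "HOL-Analysis.Analysis"
begin

section \<open>Posets and Scott topologies\<close>

text \<open>
  A poset is a carrier set together with a binary predicate, of which only the restriction
  to the carrier matters.
\<close>

definition poset_on :: "'a set \<Rightarrow> ('a \<Rightarrow> 'a \<Rightarrow> bool) \<Rightarrow> bool" where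
  "poset_on P le \<longleftrightarrow> reflp_on P le \<and> transp_on P le \<and> antisymp_on P le"

definition directed_in :: "'a set \<Rightarrow> ('a \<Rightarrow> 'a \<Rightarrow> bool) \<Rightarrow> 'a set \<Rightarrow> bool" where
  "directed_in P le D \<longleftrightarrow>
     D \<subseteq> P \<and> D \<noteq> {} \<and> (\<forall>x\<in>D. \<forall>y\<in>D. \<exists>z\<in>D. le x z \<and> le y z)"

definition is_lub_in :: "'a set \<Rightarrow> ('a \<Rightarrow> 'a \<Rightarrow> bool) \<Rightarrow> 'a set \<Rightarrow> 'a \<Rightarrow> bool" where
  "is_lub_in P le D s \<longleftrightarrow>
     s \<in> P \<and> (\<forall>x\<in>D. le x s) \<and> (\<forall>u\<in>P. (\<forall>x\<in>D. le x u) \<longrightarrow> le s u)"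

definition dcpo_on :: "'a set \<Rightarrow> ('a \<Rightarrow> 'a \<Rightarrow> bool) \<Rightarrow> bool" where
  "dcpo_on P le \<longleftrightarrow> poset_on P le \<and> (\<forall>D. directed_in P le D \<longrightarrow> (\<exists>s. is_lub_in P le D s))"

definition way_below_in :: "'a set \<Rightarrow> ('a \<Rightarrow> 'a \<Rightarrow> bool) \<Rightarrow> 'a \<Rightarrow> 'a \<Rightarrow> bool" where
  "way_below_in P le x y \<longleftrightarrow> x \<in> P \<and> y \<in> P \<and>
     (\<forall>D s. directed_in P le D \<and> is_lub_in P le D s \<and> le y s \<longrightarrow> (\<exists>z\<in>D. le x z))"

definition continuous_poset_on :: "'a set \<Rightarrow> ('a \<Rightarrow> 'a \<Rightarrow> bool) \<Rightarrow> bool" where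
  "continuous_poset_on P le \<longleftrightarrow> poset_on P le \<and>
     (\<forall>y\<in>P. directed_in P le {x. way_below_in P le x y} \<and>
            is_lub_in P le {x. way_below_in P le x y} y)"

definition scott_open_in :: "'a set \<Rightarrow> ('a \<Rightarrow> 'a \<Rightarrow> bool) \<Rightarrow> 'a set \<Rightarrow> bool" where
  "scott_open_in P le U \<longleftrightarrow> U \<subseteq> P \<and>
     (\<forall>x\<in>U. \<forall>y\<in>P. le x y \<longrightarrow> y \<in> U) \<and>
     (\<forall>D s. directed_in P le D \<and> is_lub_in P le D s \<and> s \<in> U \<longrightarrow> D \<inter> U \<noteq> {})"

definition scott_topology :: "'a set \<Rightarrow> ('a \<Rightarrow> 'a \<Rightarrow> bool) \<Rightarrow> 'a topology" where
  "scott_topology P le = topology (scott_open_in P le)"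

lemma istopology_scott_open_in: "istopology (scott_open_in P le)"
  unfolding istopology_def
proof (intro conjI allI impI)
  fix U V assume U: "scott_open_in P le U" and V: "scott_open_in P le V"
  show "scott_open_in P le (U \<inter> V)"
    unfolding scott_open_in_def
  proof (intro conjI allI impI)
    show "U \<inter> V \<subseteq> P" "\<forall>x\<in>U \<inter> V. \<forall>y\<in>P. le x y \<longrightarrow> y \<in> U \<inter> V"
      using U V by (auto simp: scott_open_in_def)
  next
    fix D s assume *: "directed_in P le D \<and> is_lub_in P le D s \<and> s \<in> U \<inter> V"
    then obtain x y where x: "x \<in> D" "x \<in> U" and y: "y \<in> D" "y \<in> V"
      using U V unfolding scott_open_in_def by blast
    then obtain z where z: "z \<in> D" "le x z" "le y z"
      using * unfolding directed_in_def by blast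
    moreover have "z \<in> P"
      using * z by (auto simp: directed_in_def)
    ultimately show "D \<inter> (U \<inter> V) \<noteq> {}"
      using U V x y unfolding scott_open_in_def by blast
  qed
next
  fix K assume K: "\<forall>U\<in>K. scott_open_in P le U"
  show "scott_open_in P le (\<Union> K)"
    unfolding scott_open_in_def
  proof (intro conjI allI impI)
    show "\<Union> K \<subseteq> P" "\<forall>x\<in>\<Union> K. \<forall>y\<in>P. le x y \<longrightarrow> y \<in> \<Union> K"
      using K unfolding scott_open_in_def by blast+
  next
    fix D s assume *: "directed_in P le D \<and> is_lub_in P le D s \<and> s \<in> \<Union> K"
    then obtain U where "U \<in> K" "s \<in> U" by blast
    moreover from this have "D \<inter> U \<noteq> {}"
      using K * unfolding scott_open_in_def by blast
    ultimately show "D \<inter> \<Union> K \<noteq> {}" by blast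
  qed
qed

lemma openin_scott_topology: "openin (scott_topology P le) U \<longleftrightarrow> scott_open_in P le U"
  by (simp add: scott_topology_def topology_inverse' istopology_scott_open_in)

lemma topspace_scott_topology [simp]: "topspace (scott_topology P le) = P"
proof
  show "topspace (scott_topology P le) \<subseteq> P"
    by (auto simp: topspace_def openin_scott_topology scott_open_in_def)
  have "scott_open_in P le P"
    by (auto simp: scott_open_in_def directed_in_def)
  then show "P \<subseteq> topspace (scott_topology P le)"
    by (simp add: openin_scott_topology openin_subset)
qed

section \<open>Quasi-metric spaces and formal balls\<close>

definition quasi_metric :: "'a set \<Rightarrow> ('a \<Rightarrow> 'a \<Rightarrow> ennreal) \<Rightarrow> bool" where
  "quasi_metric X d \<longleftrightarrow>
     (\<forall>x\<in>X. d x x = 0) \<and>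
     (\<forall>x\<in>X. \<forall>y\<in>X. \<forall>z\<in>X. d x z \<le> d x y + d y z) \<and>
     (\<forall>x\<in>X. \<forall>y\<in>X. d x y = 0 \<and> d y x = 0 \<longrightarrow> x = y)"

definition formal_balls :: "'a set \<Rightarrow> ('a \<times> real) set" where
  "formal_balls X = X \<times> {0..}"

text \<open>
  The conjunct \<open>s \<le> r\<close> is needed because \<open>ennreal\<close> sends negative reals to 0.
\<close>

definition ball_le :: "('a \<Rightarrow> 'a \<Rightarrow> ennreal) \<Rightarrow> 'a \<times> real \<Rightarrow> 'a \<times> real \<Rightarrow> bool" where
  "ball_le d = (\<lambda>(x, r) (y, s). s \<le> r \<and> d x y \<le> ennreal (r - s))"

lemma poset_on_formal_balls:
  assumes "quasi_metric X d"
  shows "poset_on (formal_balls X) (ball_le d)"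
  unfolding poset_on_def
proof (intro conjI)
  show "reflp_on (formal_balls X) (ball_le d)"
    using assms by (auto simp: reflp_on_def formal_balls_def ball_le_def quasi_metric_def)
  show "antisymp_on (formal_balls X) (ball_le d)"
    using assms by (auto simp: antisymp_on_def formal_balls_def ball_le_def quasi_metric_def)
  show "transp_on (formal_balls X) (ball_le d)"
  proof (rule transp_onI, clarsimp simp: formal_balls_def ball_le_def)
    fix x y z and r s t :: real
    assume X: "x \<in> X" "y \<in> X" "z \<in> X" and le: "s \<le> r" "t \<le> s"
      and d: "d x y \<le> ennreal (r - s)" "d y z \<le> ennreal (s - t)"
    have "d x z \<le> d x y + d y z"
      using assms X unfolding quasi_metric_def by blast
    also have "\<dots> \<le> ennreal (r - s) + ennreal (s - t)"
      using d by (rule add_mono)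
    also have "\<dots> = ennreal (r - t)"
      using le by (simp flip: ennreal_plus)
    finally show "d x z \<le> ennreal (r - t)" .
  qed
qed

definition ball_topology :: "'a set \<Rightarrow> ('a \<Rightarrow> 'a \<Rightarrow> ennreal) \<Rightarrow> ('a \<times> real) topology" where
  "ball_topology X d = scott_topology (formal_balls X) (ball_le d)"

definition d_scott_topology :: "'a set \<Rightarrow> ('a \<Rightarrow> 'a \<Rightarrow> ennreal) \<Rightarrow> 'a topology" where
  "d_scott_topology X d = pullback_topology X (\<lambda>x. (x, 0)) (ball_topology X d)"

definition continuous_yoneda_complete :: "'a set \<Rightarrow> ('a \<Rightarrow> 'a \<Rightarrow> ennreal) \<Rightarrow> bool" where
  "continuous_yoneda_complete X d \<longleftrightarrow>
     dcpo_on (formal_balls X) (ball_le d) \<and> continuous_poset_on (formal_balls X) (ball_le d)"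

definition lipschitz_continuous ::
  "real \<Rightarrow> 'a set \<Rightarrow> ('a \<Rightarrow> 'a \<Rightarrow> ennreal) \<Rightarrow> 'b set \<Rightarrow> ('b \<Rightarrow> 'b \<Rightarrow> ennreal) \<Rightarrow> ('a \<Rightarrow> 'b) \<Rightarrow> bool"
  where
  "lipschitz_continuous \<alpha> X d Y e f \<longleftrightarrow>
     continuous_map (ball_topology X d) (ball_topology Y e) (\<lambda>(x, r). (f x, \<alpha> * r))"

section \<open>Function spaces\<close>

text \<open>
  The explicit case distinction matters: on \<open>ennreal\<close>, \<open>\<infinity> - \<infinity> = \<infinity>\<close>.
\<close>

definition dR :: "ennreal \<Rightarrow> ennreal \<Rightarrow> ennreal" where
  "dR x y = (if x \<le> y then 0 else if x = \<infinity> then \<infinity> else x - y)"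

text \<open>
  Functions on \<open>X\<close> are represented by functions on the whole type that are \<open>undefined\<close>
  outside \<open>X\<close>, so that equality is equality on \<open>X\<close>.
\<close>

definition lsc_maps :: "'a set \<Rightarrow> ('a \<Rightarrow> 'a \<Rightarrow> ennreal) \<Rightarrow> ('a \<Rightarrow> ennreal) set" where
  "lsc_maps X d =
     {f \<in> extensional X. continuous_map (d_scott_topology X d) (scott_topology UNIV (\<le>)) f}"

definition lsc_topology :: "'a set \<Rightarrow> ('a \<Rightarrow> 'a \<Rightarrow> ennreal) \<Rightarrow> ('a \<Rightarrow> ennreal) topology" where
  "lsc_topology X d = scott_topology (lsc_maps X d) (\<lambda>f g. \<forall>x\<in>X. f x \<le> g x)"

definition lipschitz_maps ::
  "real \<Rightarrow> 'a set \<Rightarrow> ('a \<Rightarrow> 'a \<Rightarrow> ennreal) \<Rightarrow> ('a \<Rightarrow> ennreal) set" where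
  "lipschitz_maps \<alpha> X d = {f \<in> extensional X. lipschitz_continuous \<alpha> X d UNIV dR f}"

definition bounded_lipschitz_maps ::
  "real \<Rightarrow> real \<Rightarrow> 'a set \<Rightarrow> ('a \<Rightarrow> 'a \<Rightarrow> ennreal) \<Rightarrow> ('a \<Rightarrow> ennreal) set" where
  "bounded_lipschitz_maps \<alpha> a X d =
     {f \<in> lipschitz_maps \<alpha> X d. \<forall>x\<in>X. f x \<le> ennreal (\<alpha> * a)}"

text \<open>
  The empty intersection is included among the finite ones, so \<open>F\<close> itself is open even though
  the zero function lies in no subbasic open set.
\<close>

definition pointwise_topology :: "'a set \<Rightarrow> ('a \<Rightarrow> ennreal) set \<Rightarrow> ('a \<Rightarrow> ennreal) topology" where
  "pointwise_topology X F = topology (arbitrary union_of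
     (finite intersection_of (\<lambda>U. \<exists>x\<in>X. \<exists>r\<ge>0. U = {f. ennreal r < f x}) relative_to F))"

end

theory Submission
  imports Defs
begin

text \<open>
  If \<open>f\<close> is \<open>\<alpha>\<close>-Lipschitz continuous, then \<open>(x, r) \<mapsto> f x - \<alpha> * r\<close> is Scott-continuous on formal
  balls. As formal balls form a continuous poset, \<open>f\<close> is the directed supremum of the finite
  suprema of step functions with value \<open>t\<close> on \<open>{z. (x, r) \<lless> (z, 0)}\<close>, where
  \<open>t + \<alpha> * r < f x\<close>. A Scott-open set containing \<open>f\<close> therefore contains such a finite supremum,
  and an \<open>\<alpha>\<close>-Lipschitz continuous \<open>g\<close> lies above it as soon as \<open>t + \<alpha> * r < g x\<close> for the finitely
  many triples \<open>(x, r, t)\<close> involved, which is a pointwise open condition on \<open>g\<close>.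
\<close>

section \<open>The way-below relation and Scott-open sets in continuous posets\<close>

lemma way_below_in_imp_le:
  assumes "poset_on P le" "way_below_in P le x y"
  shows "le x y"
proof -
  have "y \<in> P" "le y y"
    using assms by (auto simp: way_below_in_def poset_on_def reflp_on_def)
  then have "directed_in P le {y}" "is_lub_in P le {y} y"
    by (auto simp: directed_in_def is_lub_in_def)
  with \<open>le y y\<close> show ?thesis
    using assms(2) unfolding way_below_in_def by blast
qed

lemma way_below_in_trans:
  assumes "poset_on P le" "x \<in> P" "le x w" "way_below_in P le w z" "z' \<in> P" "le z z'"
  shows "way_below_in P le x z'"
  unfolding way_below_in_def
proof (intro conjI allI impI)
  have tr: "transp_on P le" and wz: "w \<in> P" "z \<in> P"
    using assms by (auto simp: poset_on_def way_below_in_def)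
  fix D s assume D: "directed_in P le D \<and> is_lub_in P le D s \<and> le z' s"
  then have "s \<in> P" "D \<subseteq> P"
    by (auto simp: is_lub_in_def directed_in_def)
  with D have "le z s"
    using transp_onD[OF tr wz(2) assms(5)] assms(6) by blast
  then obtain v where "v \<in> D" "le w v"
    using D assms(4) unfolding way_below_in_def by blast
  with \<open>D \<subseteq> P\<close> show "\<exists>v\<in>D. le x v"
    using transp_onD[OF tr assms(2) wz(1)] assms(3) by blast
qed (use assms in auto)

text \<open>This is interpolation in disguise: if \<open>b\<close> is way below the supremum
  \<open>s\<close> of \<open>D\<close>, some \<open>w\<close> way below a member of \<open>D\<close>
  already lies above \<open>b\<close>, and then \<open>b\<close> is way below that member.\<close>

lemma scott_open_in_way_above:
  assumes P: "continuous_poset_on P le" and b: "b \<in> P"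
  shows "scott_open_in P le {y. way_below_in P le b y}"
  unfolding scott_open_in_def
proof (intro conjI allI impI ballI)
  have po: "poset_on P le" and refl: "\<And>x. x \<in> P \<Longrightarrow> le x x"
    and tr: "\<And>x y z. x \<in> P \<Longrightarrow> y \<in> P \<Longrightarrow> z \<in> P \<Longrightarrow> le x y \<Longrightarrow> le y z \<Longrightarrow> le x z"
    using P by (auto simp: continuous_poset_on_def poset_on_def reflp_on_def dest: transp_onD)
  show "{y. way_below_in P le b y} \<subseteq> P"
    by (auto simp: way_below_in_def)
  show "y \<in> {y. way_below_in P le b y}"
    if "x \<in> {y. way_below_in P le b y}" "y \<in> P" "le x y" for x y
    using way_below_in_trans[OF po b refl[OF b] _ that(2,3)] that(1) by simp
  fix D s assume D: "directed_in P le D \<and> is_lub_in P le D s \<and> s \<in> {y. way_below_in P le b y}"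
  then have DP: "D \<subseteq> P" and sP: "s \<in> P" and bs: "way_below_in P le b s"
    by (auto simp: directed_in_def is_lub_in_def)
  \<comment> \<open>By continuity each \<open>z\<close> in \<open>D\<close> is the directed supremum
    of the elements way below it, so \<open>E\<close> is again directed with supremum
    \<open>s\<close>. Applying \<open>b\<close> way below \<open>s\<close> to \<open>E\<close>
    rather than to \<open>D\<close> yields the interpolating element.\<close>
  define E where "E = {w. \<exists>z\<in>D. way_below_in P le w z}"
  have EP: "E \<subseteq> P"
    by (auto simp: E_def way_below_in_def)
  have wb: "directed_in P le {x. way_below_in P le x z}" "is_lub_in P le {x. way_below_in P le x z} z"
    if "z \<in> P" for z
    using P that by (auto simp: continuous_poset_on_def)
  have "directed_in P le E"
    unfolding directed_in_def
  proof (intro conjI ballI)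
    show "E \<subseteq> P" by fact
    obtain z where "z \<in> D" using D by (auto simp: directed_in_def)
    then show "E \<noteq> {}"
      using wb(1)[of z] DP unfolding directed_in_def E_def by blast
    fix w1 w2 assume "w1 \<in> E" "w2 \<in> E"
    then obtain z1 z2 where z: "z1 \<in> D" "way_below_in P le w1 z1" "z2 \<in> D" "way_below_in P le w2 z2"
      by (auto simp: E_def)
    then obtain z where z': "z \<in> D" "le z1 z" "le z2 z"
      using D unfolding directed_in_def by blast
    then have "way_below_in P le w1 z" "way_below_in P le w2 z"
      using way_below_in_trans[OF po _ refl] z DP unfolding way_below_in_def by blast+
    then show "\<exists>w\<in>E. le w1 w \<and> le w2 w"
      using wb(1)[of z] z'(1) DP unfolding directed_in_def E_def by blast
  qed
  moreover have "is_lub_in P le E s"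
    unfolding is_lub_in_def
  proof (intro conjI ballI impI)
    show "s \<in> P" by fact
    show "le w s" if wE: "w \<in> E" for w
    proof -
      obtain z where "z \<in> D" "way_below_in P le w z"
        using wE by (auto simp: E_def)
      moreover from this have "le w z" "le z s"
        using way_below_in_imp_le[OF po] D by (auto simp: is_lub_in_def)
      ultimately show ?thesis
        using tr[of w z s] wE EP DP sP by blast
    qed
    fix u assume u: "u \<in> P" "\<forall>x\<in>E. le x u"
    then have "le z u" if "z \<in> D" for z
      using wb(2)[of z] that DP unfolding is_lub_in_def E_def by blast
    with D u(1) show "le s u"
      by (auto simp: is_lub_in_def)
  qed
  ultimately obtain w where "w \<in> E" "le b w"
    using bs refl[OF sP] unfolding way_below_in_def by blast
  then obtain z where "z \<in> D" "way_below_in P le w z"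
    by (auto simp: E_def)
  then have "way_below_in P le b z"
    using way_below_in_trans[OF po b \<open>le b w\<close>] refl DP by blast
  with \<open>z \<in> D\<close> show "D \<inter> {y. way_below_in P le b y} \<noteq> {}"
    by blast
qed

section \<open>Scott topology on the extended half-line and lower semicontinuous maps\<close>

lemma is_lub_in_UNIV_le_iff [simp]:
  "is_lub_in UNIV (\<le>) D s \<longleftrightarrow> s = (Sup D :: 'a :: complete_lattice)"
  unfolding is_lub_in_def by (metis UNIV_I Sup_eqI Sup_least Sup_upper)

lemma scott_open_in_greaterThan:
  "scott_open_in UNIV (\<le>) {t<..}" for t :: "'a :: complete_linorder"
  by (auto simp: scott_open_in_def less_Sup_iff)

text \<open>A Scott-open set containing 0 is everything, by upward closure. Any \<open>v\<close>
  other than 0 is the supremum of the chain of elements strictly below it, so one of these is in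
  \<open>V\<close>; it is finite because it is below \<open>v\<close>. The case \<open>UNIV\<close>
  is separate because no open ray contains 0.\<close>

lemma scott_open_in_ennreal_cases:
  assumes "scott_open_in UNIV (\<le>) V" "v \<in> V"
  shows "V = UNIV \<or> (\<exists>t\<ge>0. ennreal t < v \<and> {ennreal t<..} \<subseteq> V)"
proof (cases "v = 0")
  case True
  then show ?thesis
    using assms by (auto simp: scott_open_in_def)
next
  case False
  have "directed_in UNIV (\<le>) {..<v}"
    unfolding directed_in_def
  proof (intro conjI ballI)
    show "{..<v} \<noteq> {}"
      using False by (metis empty_iff lessThan_iff zero_less_iff_neq_zero)
    show "\<exists>z\<in>{..<v}. x \<le> z \<and> y \<le> z" if "x \<in> {..<v}" "y \<in> {..<v}" for x y
      using that by (intro bexI[of _ "max x y"]) auto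
  qed simp
  moreover have "is_lub_in UNIV (\<le>) {..<v} v"
    by simp
  ultimately obtain t where t: "t < v" "t \<in> V"
    using assms unfolding scott_open_in_def by blast
  then obtain q where "t = ennreal q" "q \<ge> 0"
    by (cases t) auto
  moreover have "{t<..} \<subseteq> V"
    using t(2) assms(1) by (auto simp: scott_open_in_def)
  ultimately show ?thesis
    using t(1) by blast
qed

lemma topspace_d_scott_topology [simp]: "topspace (d_scott_topology X d) = X"
  by (auto simp: d_scott_topology_def ball_topology_def topspace_pullback_topology formal_balls_def)

lemma openin_d_scott_topologyI:
  "scott_open_in (formal_balls X) (ball_le d) U \<Longrightarrow> openin (d_scott_topology X d) {x \<in> X. (x, 0) \<in> U}"
  by (auto simp: d_scott_topology_def ball_topology_def openin_pullback_topology openin_scott_topology)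

text \<open>The open rays with finite endpoint, together with the whole space, form a base of the
  Scott topology on \<open>ennreal\<close>, so continuity can be tested on rays.\<close>

lemma lsc_maps_iff:
  "f \<in> lsc_maps X d \<longleftrightarrow> f \<in> extensional X \<and>
     (\<forall>t\<ge>0. openin (d_scott_topology X d) {x \<in> X. ennreal t < f x})"
proof -
  have "continuous_map (d_scott_topology X d) (scott_topology UNIV (\<le>)) f \<longleftrightarrow>
        (\<forall>t\<ge>0. openin (d_scott_topology X d) {x \<in> X. ennreal t < f x})" (is "?L \<longleftrightarrow> ?R")
  proof
    assume ?L
    then show ?R
      using scott_open_in_greaterThan
      by (fastforce simp: continuous_map_def openin_scott_topology)
  next
    assume R: ?R
    have "openin (d_scott_topology X d) {x \<in> X. f x \<in> V}" if V: "scott_open_in UNIV (\<le>) V" for V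
    proof (subst openin_subopen, intro ballI)
      fix x assume x: "x \<in> {x \<in> X. f x \<in> V}"
      then consider "V = UNIV" | t where "t \<ge> 0" "ennreal t < f x" "{ennreal t<..} \<subseteq> V"
        using scott_open_in_ennreal_cases[OF V] by blast
      then show "\<exists>T. openin (d_scott_topology X d) T \<and> x \<in> T \<and> T \<subseteq> {x \<in> X. f x \<in> V}"
      proof cases
        case 1
        then show ?thesis
          using x openin_topspace[of "d_scott_topology X d"] by auto
      next
        case 2
        then show ?thesis
          using x R by (intro exI[of _ "{x \<in> X. ennreal t < f x}"]) auto
      qed
    qed
    then show ?L
      by (auto simp: continuous_map_def openin_scott_topology)
  qed
  then show ?thesis
    by (auto simp: lsc_maps_def)
qed

lemma SUP_in_lsc_maps:
  assumes "D \<subseteq> lsc_maps X d"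
  shows "(\<lambda>x\<in>X. SUP f\<in>D. f x) \<in> lsc_maps X d"
  unfolding lsc_maps_iff
proof (intro conjI allI impI)
  fix t :: real assume "t \<ge> 0"
  have "{x \<in> X. ennreal t < (\<lambda>x\<in>X. SUP f\<in>D. f x) x} = (\<Union>f\<in>D. {x \<in> X. ennreal t < f x})"
    by (auto simp: less_SUP_iff)
  then show "openin (d_scott_topology X d) {x \<in> X. ennreal t < (\<lambda>x\<in>X. SUP f\<in>D. f x) x}"
    using assms \<open>t \<ge> 0\<close> by (auto simp: lsc_maps_iff simp del: restrict_apply intro!: openin_Union)
qed simp

text \<open>The pointwise supremum of \<open>D\<close> is itself lower semicontinuous, hence an
  upper bound of \<open>D\<close> inside the function space. The least upper bound \<open>s\<close>
  is therefore below it, and \<open>s x\<close> exceeds the threshold only if some member of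
  \<open>D\<close> does at \<open>x\<close>.\<close>

lemma openin_lsc_topology_superlevel:
  assumes "x \<in> X"
  shows "openin (lsc_topology X d) {f \<in> lsc_maps X d. ennreal t < f x}"
  unfolding lsc_topology_def openin_scott_topology scott_open_in_def
proof (intro conjI allI impI ballI)
  fix D s
  assume D: "directed_in (lsc_maps X d) (\<lambda>f g. \<forall>x\<in>X. f x \<le> g x) D \<and>
    is_lub_in (lsc_maps X d) (\<lambda>f g. \<forall>x\<in>X. f x \<le> g x) D s \<and> s \<in> {f \<in> lsc_maps X d. ennreal t < f x}"
  then have DL: "D \<subseteq> lsc_maps X d"
    by (simp add: directed_in_def)
  have "\<forall>f\<in>D. \<forall>x\<in>X. f x \<le> (\<lambda>x\<in>X. SUP f\<in>D. f x) x"
    by (auto intro: SUP_upper)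
  then have "s x \<le> (SUP f\<in>D. f x)"
    using D SUP_in_lsc_maps[OF DL] assms unfolding is_lub_in_def by fastforce
  then have "ennreal t < (SUP f\<in>D. f x)"
    using D by (auto intro: less_le_trans)
  then show "D \<inter> {f \<in> lsc_maps X d. ennreal t < f x} \<noteq> {}"
    using DL by (auto simp: less_SUP_iff)
qed (use assms in \<open>auto intro: less_le_trans\<close>)

section \<open>Formal balls over the extended half-line and Lipschitz continuous maps\<close>

lemma ball_le_dR_iff:
  "ball_le dR (y, r) (z, s) \<longleftrightarrow> s \<le> r \<and> y \<le> z + ennreal (r - s)"
  by (cases y; cases z)
    (auto simp: ball_le_def dR_def ennreal_minus ennreal_le_iff2 top_unique simp flip: ennreal_plus)

text \<open>Informally this is the set where \<open>y - r > t\<close>; the additive form avoids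
  truncated subtraction and infinite values.\<close>

lemma scott_open_in_ball_dR:
  assumes "t \<ge> 0"
  shows "scott_open_in (formal_balls UNIV) (ball_le dR)
           {(y, r). r \<ge> 0 \<and> ennreal (t + r) < y}" (is "scott_open_in ?B _ ?U")
  unfolding scott_open_in_def
proof (intro conjI allI impI ballI)
  show "?U \<subseteq> ?B"
    by (auto simp: formal_balls_def)
  show "b' \<in> ?U" if "b \<in> ?U" "b' \<in> ?B" "ball_le dR b b'" for b b'
  proof -
    obtain y r z s where b: "b = (y, r)" "b' = (z, s)"
      by (metis surj_pair)
    have "ennreal (t + r) < z + ennreal (r - s)" "0 \<le> s" "s \<le> r"
      using that unfolding b by (auto simp: ball_le_dR_iff formal_balls_def intro: less_le_trans)
    then show ?thesis
      using assms unfolding b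
      by (cases z) (auto simp: ennreal_less_iff simp flip: ennreal_plus)
  qed
  fix D c assume D: "directed_in ?B (ball_le dR) D \<and> is_lub_in ?B (ball_le dR) D c \<and> c \<in> ?U"
  obtain y r where c: "c = (y, r)" by force
  have DB: "D \<subseteq> ?B" and "D \<noteq> {}" and ub: "\<And>b. b \<in> D \<Longrightarrow> ball_le dR b (y, r)"
    and least: "\<And>u. u \<in> ?B \<Longrightarrow> \<forall>b\<in>D. ball_le dR b u \<Longrightarrow> ball_le dR (y, r) u"
    and yr: "ennreal (t + r) < y"
    using D by (auto simp: directed_in_def is_lub_in_def c)
  show "D \<inter> ?U \<noteq> {}"
  proof
    assume "D \<inter> ?U = {}"
    then have le: "z \<le> ennreal (t + s)" if "(z, s) \<in> D" for z s
      using that DB by (force simp: formal_balls_def)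
    \<comment> \<open>If \<open>D\<close> misses the set, every \<open>(z, s)\<close> in
      \<open>D\<close> satisfies \<open>z \<le> t + s\<close>. With \<open>m\<close> the infimum of
      the radii, \<open>t + s = (t + m) + (s - m)\<close>, so the ball \<open>(t + m, m)\<close> is
      an upper bound of \<open>D\<close>.\<close>
    define m where "m = (INF b\<in>D. snd b)"
    have bdd: "bdd_below (snd ` D)"
      using DB by (intro bdd_belowI2[where m = 0]) (auto simp: formal_balls_def)
    have m0: "m \<ge> 0"
      using \<open>D \<noteq> {}\<close> DB unfolding m_def by (intro cINF_greatest) (auto simp: formal_balls_def)
    have ml: "m \<le> s" if "(z, s) \<in> D" for z s
      using cINF_lower[OF bdd that] by (simp add: m_def)
    have rm: "r \<le> m"
      using \<open>D \<noteq> {}\<close> ub unfolding m_def by (intro cINF_greatest) (auto simp: ball_le_def)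
    have "ball_le dR b (ennreal (t + m), m)" if "b \<in> D" for b
      using le ml that m0 assms
      by (cases b) (force simp: ball_le_dR_iff simp flip: ennreal_plus)
    then have "ball_le dR (y, r) (ennreal (t + m), m)"
      using m0 by (intro least) (auto simp: formal_balls_def)
    \<comment> \<open>Lying below \<open>(t + m, m)\<close> gives \<open>m \<le> r\<close>, hence
      \<open>m = r\<close>, and the ball order reduces to this inequality.\<close>
    then have "y \<le> ennreal (t + r)"
      using rm by (auto simp: ball_le_dR_iff)
    with yr show False by simp
  qed
qed

text \<open>Pull back the open set where \<open>y - r > t\<close> along the map of formal balls
  induced by \<open>f\<close>. Nonnegativity of \<open>\<alpha>\<close> keeps the radii
  \<open>\<alpha> * r\<close> nonnegative.\<close>

lemma scott_open_in_lipschitz_superlevel: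
  assumes "\<alpha> \<ge> 0" "f \<in> lipschitz_maps \<alpha> X d" "t \<ge> 0"
  shows "scott_open_in (formal_balls X) (ball_le d)
           {(x, r) \<in> formal_balls X. ennreal (t + \<alpha> * r) < f x}"
proof -
  have "continuous_map (ball_topology X d) (ball_topology UNIV dR) (\<lambda>(x, r). (f x, \<alpha> * r))"
    using assms by (simp add: lipschitz_maps_def lipschitz_continuous_def)
  then have "openin (ball_topology X d) {b \<in> topspace (ball_topology X d).
      (\<lambda>(x, r). (f x, \<alpha> * r)) b \<in> {(y, r). r \<ge> 0 \<and> ennreal (t + r) < y}}"
    using scott_open_in_ball_dR[OF assms(3)]
    by (intro openin_continuous_map_preimage) (auto simp: ball_topology_def openin_scott_topology)
  moreover have "{b \<in> topspace (ball_topology X d).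
      (\<lambda>(x, r). (f x, \<alpha> * r)) b \<in> {(y, r). r \<ge> 0 \<and> ennreal (t + r) < y}} =
      {(x, r) \<in> formal_balls X. ennreal (t + \<alpha> * r) < f x}"
    using assms(1) by (auto simp: ball_topology_def formal_balls_def)
  ultimately show ?thesis
    by (simp add: ball_topology_def openin_scott_topology)
qed

text \<open>Restricting the open superlevel sets of formal balls to radius 0 gives the superlevel
  sets of \<open>f\<close>.\<close>

lemma lipschitz_maps_subset_lsc_maps:
  assumes "\<alpha> \<ge> 0"
  shows "lipschitz_maps \<alpha> X d \<subseteq> lsc_maps X d"
proof
  fix f assume f: "f \<in> lipschitz_maps \<alpha> X d"
  have "openin (d_scott_topology X d) {x \<in> X. ennreal t < f x}" if "t \<ge> 0" for t
    using openin_d_scott_topologyI[OF scott_open_in_lipschitz_superlevel[OF assms f that]]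
    by (simp add: formal_balls_def cong: conj_cong)
  then show "f \<in> lsc_maps X d"
    using f by (auto simp: lsc_maps_iff lipschitz_maps_def)
qed

section \<open>Approximation of Lipschitz continuous maps by suprema of step functions\<close>

text \<open>Each \<open>(b, t)\<close> in \<open>E\<close> contributes a step of height
  \<open>t\<close>. Its support is cut out by the way-below relation, not by the ball order, so that
  it is open. Where no step applies the supremum is empty and the value is 0.\<close>

definition step_sup ::
  "'a set \<Rightarrow> ('a \<Rightarrow> 'a \<Rightarrow> ennreal) \<Rightarrow> (('a \<times> real) \<times> real) set \<Rightarrow> 'a \<Rightarrow> ennreal" where
  "step_sup X d E = (\<lambda>x\<in>X. SUP (b, t)\<in>{(b, t) \<in> E.
     way_below_in (formal_balls X) (ball_le d) b (x, 0)}. ennreal t)"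

lemma step_sup_in_lsc_maps:
  assumes "continuous_poset_on (formal_balls X) (ball_le d)" "E \<subseteq> formal_balls X \<times> UNIV"
  shows "step_sup X d E \<in> lsc_maps X d"
  unfolding lsc_maps_iff
proof (intro conjI allI impI)
  fix q :: real assume "q \<ge> 0"
  have "{x \<in> X. ennreal q < step_sup X d E x} = (\<Union>(b, t)\<in>{(b, t) \<in> E. ennreal q < ennreal t}.
      {x \<in> X. (x, 0) \<in> {c. way_below_in (formal_balls X) (ball_le d) b c}})"
    by (auto simp: step_sup_def less_SUP_iff)
  moreover have "openin (d_scott_topology X d) \<dots>"
    using assms(2)
    by (intro openin_Union)
      (auto intro!: openin_d_scott_topologyI[where U = "Collect _", simplified] scott_open_in_way_above[OF assms(1)])
  ultimately show "openin (d_scott_topology X d) {x \<in> X. ennreal q < step_sup X d E x}"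
    by simp
qed (simp add: step_sup_def)

text \<open>The superlevel set of \<open>g\<close> among formal balls is upward closed. It contains
  \<open>(y, r)\<close>, so it contains every \<open>(x, 0)\<close> above \<open>(y, r)\<close>,
  which says \<open>t < g x\<close>.\<close>

lemma step_sup_le_lipschitz:
  assumes "poset_on (formal_balls X) (ball_le d)" "\<alpha> \<ge> 0" "g \<in> lipschitz_maps \<alpha> X d"
    and E: "\<And>y r t. ((y, r), t) \<in> E \<Longrightarrow> t \<ge> 0 \<and> ennreal (t + \<alpha> * r) < g y"
    and "x \<in> X"
  shows "step_sup X d E x \<le> g x"
proof -
  have "ennreal t \<le> g x"
    if "((y, r), t) \<in> E" "way_below_in (formal_balls X) (ball_le d) (y, r) (x, 0)" for y r t
  proof -
    have "t \<ge> 0" "(y, r) \<in> {(x, r) \<in> formal_balls X. ennreal (t + \<alpha> * r) < g x}"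
      "(x, 0) \<in> formal_balls X" "ball_le d (y, r) (x, 0)"
      using E[OF that(1)] that(2) way_below_in_imp_le[OF assms(1) that(2)]
      by (auto simp: way_below_in_def)
    then have "(x, 0) \<in> {(x, r) \<in> formal_balls X. ennreal (t + \<alpha> * r) < g x}"
      using scott_open_in_lipschitz_superlevel[OF assms(2,3) \<open>t \<ge> 0\<close>]
      unfolding scott_open_in_def by blast
    then show ?thesis
      by (simp add: less_imp_le)
  qed
  then show ?thesis
    using \<open>x \<in> X\<close> by (auto simp: step_sup_def intro!: SUP_least)
qed

text \<open>The suprema of finitely many admissible steps form a directed family with least upper
  bound \<open>f\<close>, so the Scott-open set \<open>W\<close> contains one of them.\<close>

lemma lipschitz_step_sup_in_scott_open:
  assumes P: "continuous_poset_on (formal_balls X) (ball_le d)" and "\<alpha> \<ge> 0"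
    and f: "f \<in> lipschitz_maps \<alpha> X d" and W: "openin (lsc_topology X d) W" "f \<in> W"
  obtains E where "finite E"
    "E \<subseteq> {((x, r), t). x \<in> X \<and> r \<ge> 0 \<and> t \<ge> 0 \<and> ennreal (t + \<alpha> * r) < f x}" "step_sup X d E \<in> W"
proof -
  let ?S = "{((x, r), t). x \<in> X \<and> r \<ge> 0 \<and> t \<ge> 0 \<and> ennreal (t + \<alpha> * r) < f x}"
  let ?le = "\<lambda>f g. \<forall>x\<in>X. f x \<le> (g x :: ennreal)"
  let ?D = "step_sup X d ` {E. finite E \<and> E \<subseteq> ?S}"
  have po: "poset_on (formal_balls X) (ball_le d)"
    using P by (simp add: continuous_poset_on_def)
  have mono: "step_sup X d E x \<le> step_sup X d E' x" if "E \<subseteq> E'" "x \<in> X" for E E' x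
    using that by (auto simp: step_sup_def intro!: SUP_subset_mono)
  have "directed_in (lsc_maps X d) ?le ?D"
    unfolding directed_in_def
  proof (intro conjI)
    show "?D \<subseteq> lsc_maps X d"
    proof clarify
      fix E assume "E \<subseteq> ?S"
      then show "step_sup X d E \<in> lsc_maps X d"
        by (intro step_sup_in_lsc_maps[OF P]) (auto simp: formal_balls_def)
    qed
    show "?D \<noteq> {}" by blast
    show "\<forall>g\<in>?D. \<forall>h\<in>?D. \<exists>k\<in>?D. ?le g k \<and> ?le h k"
    proof clarify
      fix E E' assume "finite E" "E \<subseteq> ?S" "finite E'" "E' \<subseteq> ?S"
      then show "\<exists>k\<in>?D. ?le (step_sup X d E) k \<and> ?le (step_sup X d E') k"
        by (intro bexI[of _ "step_sup X d (E \<union> E')"]) (auto intro!: mono)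
    qed
  qed
  moreover have "is_lub_in (lsc_maps X d) ?le ?D f"
    unfolding is_lub_in_def
  proof (intro conjI ballI impI)
    show "f \<in> lsc_maps X d"
      using f lipschitz_maps_subset_lsc_maps \<open>\<alpha> \<ge> 0\<close> by blast
    show "g x \<le> f x" if "g \<in> ?D" "x \<in> X" for g x
      using that by (auto intro!: step_sup_le_lipschitz[OF po \<open>\<alpha> \<ge> 0\<close> f])
    fix u x assume u: "\<forall>g\<in>?D. ?le g u" and x: "x \<in> X"
    show "f x \<le> u x"
    proof (rule ccontr)
      assume "\<not> f x \<le> u x"
      \<comment> \<open>An intermediate value is finite even if \<open>f x\<close> is infinite, so
        it can serve as the height of a step.\<close>
      then obtain q where q: "u x < q" "q < f x"
        using dense by (auto simp: not_le)
      then obtain t where t: "q = ennreal t" "t \<ge> 0"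
        by (cases q) auto
      have xB: "(x, 0) \<in> formal_balls X"
        using x by (simp add: formal_balls_def)
      then have "(x, 0) \<in> {(x, r) \<in> formal_balls X. ennreal (t + \<alpha> * r) < f x}"
        using q t by simp
      \<comment> \<open>The ball \<open>(x, 0)\<close> is the directed supremum of the balls way
        below it and belongs to the Scott-open superlevel set of \<open>f\<close>, so some
        \<open>(y, r)\<close> way below it is already there. The single step on
        \<open>(y, r)\<close> of height \<open>t\<close> then takes the value \<open>q\<close> at
        \<open>x\<close>, contradicting \<open>u x < q\<close>.\<close>
      then have "{b. way_below_in (formal_balls X) (ball_le d) b (x, 0)} \<inter>
          {(x, r) \<in> formal_balls X. ennreal (t + \<alpha> * r) < f x} \<noteq> {}"
        using P xB scott_open_in_lipschitz_superlevel[OF \<open>\<alpha> \<ge> 0\<close> f \<open>t \<ge> 0\<close>]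
        unfolding continuous_poset_on_def scott_open_in_def by blast
      then obtain y r where b: "way_below_in (formal_balls X) (ball_le d) (y, r) (x, 0)"
        "(y, r) \<in> formal_balls X" "ennreal (t + \<alpha> * r) < f y"
        by auto
      have "step_sup X d {((y, r), t)} \<in> ?D"
        using b t by (auto simp: formal_balls_def)
      then have "step_sup X d {((y, r), t)} x \<le> u x"
        using u x by blast
      moreover have "step_sup X d {((y, r), t)} x = q"
      proof -
        have "{(c, s) \<in> {((y, r), t)}. way_below_in (formal_balls X) (ball_le d) c (x, 0)} = {((y, r), t)}"
          using b by auto
        then show ?thesis
          unfolding step_sup_def using x t by simp
      qed
      ultimately show False
        using q by simp
    qed
  qed
  ultimately have "?D \<inter> W \<noteq> {}"
    using W unfolding lsc_topology_def openin_scott_topology scott_open_in_def by blast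
  then show thesis
    using that by blast
qed

section \<open>Comparison with the topology of pointwise convergence\<close>

lemma openin_pointwise_topologyI:
  assumes "finite \<U>" "\<And>U. U \<in> \<U> \<Longrightarrow> \<exists>x\<in>X. \<exists>r\<ge>0. U = {f. ennreal r < f x}"
  shows "openin (pointwise_topology X F) (F \<inter> \<Inter>\<U>)"
  unfolding pointwise_topology_def openin_subbase
  using assms by (intro arbitrary_union_of_inc relative_to_inc) (auto simp: intersection_of_def)

lemma topology_finer_pointwise:
  assumes top: "topspace T = F"
    and T: "\<And>x r. x \<in> X \<Longrightarrow> openin T {f \<in> F. ennreal r < f x}"
    and U: "openin (pointwise_topology X F) U"
  shows "openin T U"
proof -
  have "openin T (F \<inter> \<Inter>\<V>)"
    if "finite \<V>" "\<forall>V\<in>\<V>. \<exists>x\<in>X. \<exists>r\<ge>0. V = {f. ennreal r < f x}" for \<V>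
    using that
  proof (induction \<V>)
    case empty
    then show ?case using openin_topspace[of T] top by simp
  next
    case (insert V \<V>)
    then obtain x r where "x \<in> X" "V = {f. ennreal r < f x}"
      by auto
    then have "F \<inter> \<Inter>(insert V \<V>) = {f \<in> F. ennreal r < f x} \<inter> (F \<inter> \<Inter>\<V>)"
      by auto
    then show ?case
      using insert.IH insert.prems T[OF \<open>x \<in> X\<close>, of r] by (simp only: insert_iff) blast
  qed
  then have "openin T V"
    if "(finite intersection_of (\<lambda>U. \<exists>x\<in>X. \<exists>r\<ge>0. U = {f. ennreal r < f x}) relative_to F) V" for V
    using that unfolding relative_to_def intersection_of_def by blast
  with U show ?thesis
    unfolding pointwise_topology_def openin_subbase by (auto simp: union_of_def)
qed

text \<open>Stating this for an arbitrary set \<open>F\<close> of \<open>\<alpha>\<close>-Lipschitz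
  continuous maps treats the bounded and the unbounded function spaces at once.\<close>

lemma subtopology_lsc_eq_pointwise:
  assumes P: "continuous_poset_on (formal_balls X) (ball_le d)" and "\<alpha> \<ge> 0"
    and F: "F \<subseteq> lipschitz_maps \<alpha> X d"
  shows "subtopology (lsc_topology X d) F = pointwise_topology X F"
proof (rule topology_eq[THEN iffD2], intro allI iffI)
  have FL: "F \<subseteq> lsc_maps X d"
    using F lipschitz_maps_subset_lsc_maps \<open>\<alpha> \<ge> 0\<close> by blast
  fix U
  {
    assume "openin (pointwise_topology X F) U"
    then show "openin (subtopology (lsc_topology X d) F) U"
    proof (rule topology_finer_pointwise[rotated 2])
      show "topspace (subtopology (lsc_topology X d) F) = F"
        using FL by (auto simp: lsc_topology_def)
      fix x r assume "x \<in> X"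
      have "F \<inter> {f \<in> lsc_maps X d. ennreal r < f x} = {f \<in> F. ennreal r < f x}"
        using FL by auto
      then show "openin (subtopology (lsc_topology X d) F) {f \<in> F. ennreal r < f x}"
        using openin_subtopology_Int2[OF openin_lsc_topology_superlevel[OF \<open>x \<in> X\<close>, of d r], of F]
        by (simp only:)
    qed
  next
    assume "openin (subtopology (lsc_topology X d) F) U"
    then obtain W where W: "openin (lsc_topology X d) W" "U = W \<inter> F"
      by (auto simp: openin_subtopology)
    show "openin (pointwise_topology X F) U"
    proof (subst openin_subopen, intro ballI)
      fix f assume "f \<in> U"
      then have f: "f \<in> W" "f \<in> F" "f \<in> lipschitz_maps \<alpha> X d"
        using W F by auto
      obtain E where E: "finite E"
        "E \<subseteq> {((x, r), t). x \<in> X \<and> r \<ge> 0 \<and> t \<ge> 0 \<and> ennreal (t + \<alpha> * r) < f x}" "step_sup X d E \<in> W"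
        using lipschitz_step_sup_in_scott_open[OF P \<open>\<alpha> \<ge> 0\<close> f(3) W(1) f(1)] by blast
      \<comment> \<open>\<open>N\<close> collects the \<open>g\<close> in \<open>F\<close> for which
        all steps in \<open>E\<close> are admissible. If \<open>E\<close> is empty, as it must be
        for \<open>f = 0\<close>, then \<open>N\<close> is \<open>F\<close>.\<close>
      define N where "N = F \<inter> \<Inter>((\<lambda>((x, r), t). {g. ennreal (t + \<alpha> * r) < g x}) ` E)"
      have "openin (pointwise_topology X F) N"
        unfolding N_def
      proof (intro openin_pointwise_topologyI)
        fix V assume "V \<in> (\<lambda>((x, r), t). {g. ennreal (t + \<alpha> * r) < g x}) ` E"
        then obtain x r t where "((x, r), t) \<in> E" "V = {g. ennreal (t + \<alpha> * r) < g x}"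
          by auto
        moreover from this have "x \<in> X" "t + \<alpha> * r \<ge> 0"
          using E(2) \<open>\<alpha> \<ge> 0\<close> by auto
        ultimately show "\<exists>x\<in>X. \<exists>r\<ge>0. V = {f. ennreal r < f x}"
          by blast
      qed (use E(1) in simp)
      moreover have "f \<in> N"
        using E f by (auto simp: N_def)
      moreover have "N \<subseteq> U"
      proof
        fix g assume g: "g \<in> N"
        then have "g \<in> lipschitz_maps \<alpha> X d" "g \<in> lsc_maps X d" "g \<in> F"
          using F FL by (auto simp: N_def)
        \<comment> \<open>Since \<open>step_sup X d E\<close> is in \<open>W\<close> and
          \<open>W\<close> is upward closed, this inequality puts \<open>g\<close> in
          \<open>W\<close>.\<close>
        moreover have "\<forall>x\<in>X. step_sup X d E x \<le> g x"
          using P E(2) g calculation(1)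
          by (intro ballI step_sup_le_lipschitz[OF _ \<open>\<alpha> \<ge> 0\<close>]) (auto simp: continuous_poset_on_def N_def)
        ultimately show "g \<in> U"
          using W E(3) unfolding lsc_topology_def openin_scott_topology scott_open_in_def by blast
      qed
      ultimately show "\<exists>T. openin (pointwise_topology X F) T \<and> f \<in> T \<and> T \<subseteq> U"
        by blast
    qed
  }
qed

theorem proposition8p1:
  fixes X :: "'a set" and d :: "'a \<Rightarrow> 'a \<Rightarrow> ennreal" and \<alpha> :: real
  assumes "quasi_metric X d"
    and "continuous_yoneda_complete X d"
    and "\<alpha> \<ge> 0"
  shows "subtopology (lsc_topology X d) (lipschitz_maps \<alpha> X d)
           = pointwise_topology X (lipschitz_maps \<alpha> X d) \<and>
         (\<forall>a::real. a > 0 \<longrightarrow>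
           subtopology (lsc_topology X d) (bounded_lipschitz_maps \<alpha> a X d)
             = pointwise_topology X (bounded_lipschitz_maps \<alpha> a X d))"
proof -
  have P: "continuous_poset_on (formal_balls X) (ball_le d)"
    using assms(2) by (simp add: continuous_yoneda_complete_def)
  show ?thesis
    using subtopology_lsc_eq_pointwise[OF P assms(3)]
    by (auto simp: bounded_lipschitz_maps_def)
qed

end
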